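(* Let $\mu$ be an ultra-log-concave probability measure over $\mathbb N$. Then, for any positive $g\in L^2(\mathbb N,\mu)$, $$\mathrm{Ent}_\mu(g)\le|\log\mu(0)|\;\mathbb E_\mu[\Psi(g,Dg)],$$ where $\Psi(u,v):=(u+v)\log(u+v)-u\log u-(\log u+1)v$.
   Context: $\mathbb N=\{0,1,2,\dots\}$. For $\lambda>0$, $\pi_\lambda(k)=e^{-\lambda}\lambda^k/k!$ is the Poisson measure on $\mathbb N$. A function $f:\mathbb N\to(0,\infty)$ is log-concave if $f(k)^2\ge f(k-1)f(k+1)$ for all integers $k\ge1$. A probability measure $\mu$ on $\mathbb N$ is ultra-log-concave if $\mu(k)=f(k)\pi_\lambda(k)$ for all $k\in\mathbb N$, for some $\lambda>0$ and some positive log-concave $f:\mathbb N\to(0,\infty)$. For $g:\mathbb N\to\mathbb R$, $Dg(k):=g(k+1)-g(k)$. For positive $g$, $\mathrm{Ent}_\mu(g):=\mathbb E_\mu[g\log g]-\mathbb E_\mu[g]\log\mathbb E_\mu[g]$. *)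

theory Defs
  imports "HOL-Probability.Probability"
begin

definition log_concave :: "(nat \<Rightarrow> real) \<Rightarrow> bool" where
  "log_concave f \<longleftrightarrow> (\<forall>k\<ge>1. (f k)\<^sup>2 \<ge> f (k - 1) * f (k + 1))"

definition ultra_log_concave :: "nat pmf \<Rightarrow> bool" where
  "ultra_log_concave \<mu> \<longleftrightarrow>
     (\<exists>r>0. \<exists>f. (\<forall>k. f k > 0) \<and> log_concave f \<and> (\<forall>k. pmf \<mu> k = f k * pmf (poisson_pmf r) k))"

definition fwd_diff :: "(nat \<Rightarrow> real) \<Rightarrow> nat \<Rightarrow> real" where
  "fwd_diff g k = g (k + 1) - g k"

text \<open>
  Both expectations are Bochner integrals, hence \<open>0\<close> when the integrand is not integrable.
  For positive \<open>g\<close> in \<open>L\<^sup>2(\<mu>)\<close> both integrands are integrable, since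
  \<open>- exp (-1) \<le> g * ln g \<le> g\<^sup>2\<close>.
\<close>

definition Ent :: "nat pmf \<Rightarrow> (nat \<Rightarrow> real) \<Rightarrow> real" where
  "Ent \<mu> g = measure_pmf.expectation \<mu> (\<lambda>k. g k * ln (g k))
     - measure_pmf.expectation \<mu> g * ln (measure_pmf.expectation \<mu> g)"

definition Psi :: "real \<Rightarrow> real \<Rightarrow> real" where
  "Psi u v = (u + v) * ln (u + v) - u * ln u - (ln u + 1) * v"

text \<open>
  The expectation of \<open>Psi (g k) (fwd_diff g k)\<close> can be infinite for \<open>g\<close> in \<open>L\<^sup>2(\<mu>)\<close>, so it has
  to be taken in \<open>[0, \<infinity>]\<close> rather than as a Bochner integral.  By the following lemma, converting
  the integrand to \<^typ>\<open>ennreal\<close> truncates nothing.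
\<close>

lemma Psi_nonneg:
  assumes "u > 0" "u + v > 0"
  shows "Psi u v \<ge> 0"
proof -
  define w where "w = u + v"
  have w: "w > 0" and v: "v = w - u" using assms by (auto simp: w_def)
  have "ln (u / w) \<le> u / w - 1" using assms w by (intro ln_le_minus_one) auto
  then have "w * (ln u - ln w) \<le> w * (u / w - 1)"
    using assms w by (intro mult_left_mono) (auto simp: ln_div)
  also have "\<dots> = u - w" using w by (simp add: field_simps)
  finally show ?thesis unfolding Psi_def v by (simp add: algebra_simps)
qed

lemma Psi_fwd_diff_nonneg: "(\<And>k. g k > 0) \<Longrightarrow> Psi (g k) (fwd_diff g k) \<ge> 0"
  by (rule Psi_nonneg) (auto simp: fwd_diff_def)

end

theory Submission
  imports Defs
begin

text \<open>
  The measure is approximated by measures with weights \<open>(n choose k) f k\<close> on \<open>{0..n}\<close>, \<open>f\<close>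
  log-concave.  Such a measure is the law of a Markov chain of \<open>n\<close> steps in \<open>{0, 1}\<close>, a discrete
  analogue of the Poisson transport map.  By Pascal's rule, forgetting the last step replaces
  \<open>f\<close> by \<open>f + f(\<cdot> + 1)\<close>, which is again log-concave, and \<open>g\<close> by its average over that step.
  Entropy splits along the steps, the entropy of one step is bounded by convexity of \<open>x log x\<close>, and
  log-concavity makes the averaging contract \<open>E[Psi(g, Dg)]\<close>.  The constants of the steps are the
  odds \<open>r\<close> of leaving \<open>0\<close>, and the logarithms \<open>ln (1 + r)\<close> add up to \<open>-ln \<mu>(0)\<close>; the odds are
  \<open>O(1 / n)\<close>, so the difference between \<open>r\<close> and \<open>ln (1 + r)\<close> disappears in the limit.
\<close>

section \<open>Binomially weighted sums\<close>

definition binsum :: "nat \<Rightarrow> (nat \<Rightarrow> real) \<Rightarrow> real" where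
  "binsum n F = (\<Sum>k\<le>n. real (n choose k) * F k)"

lemma binsum_0 [simp]: "binsum 0 F = F 0"
  by (simp add: binsum_def)

text \<open>Pascal's rule, read as conditioning on the position before the last of
  \<open>n + 1\<close> steps; it drives the induction on \<open>n\<close>.\<close>

lemma binsum_Suc: "binsum (Suc n) F = binsum n (\<lambda>k. F k + F (Suc k))"
proof -
  have "binsum (Suc n) F = F 0 + (\<Sum>k\<le>n. real (Suc n choose Suc k) * F (Suc k))"
    by (simp only: binsum_def sum.atMost_Suc_shift) simp
  also have "\<dots> = F 0 + (\<Sum>k\<le>n. real (n choose Suc k) * F (Suc k)) + binsum n (\<lambda>k. F (Suc k))"
    by (simp add: binsum_def algebra_simps sum.distrib)
  also have "F 0 + (\<Sum>k\<le>n. real (n choose Suc k) * F (Suc k))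
      = (\<Sum>k\<le>Suc n. real (n choose k) * F k)"
    by (simp only: sum.atMost_Suc_shift) simp
  also have "\<dots> = binsum n F"
    by (simp add: binsum_def)
  finally show ?thesis
    by (simp add: binsum_def algebra_simps sum.distrib)
qed

lemma binsum_mono: "(\<And>k. F k \<le> G k) \<Longrightarrow> binsum n F \<le> binsum n G"
  unfolding binsum_def by (intro sum_mono mult_left_mono) auto

lemma binsum_add: "binsum n (\<lambda>k. F k + G k) = binsum n F + binsum n G"
  by (simp add: binsum_def algebra_simps sum.distrib)

lemma binsum_cmult: "binsum n (\<lambda>k. c * F k) = c * binsum n F"
  by (simp add: binsum_def sum_distrib_left mult_ac)

lemma binsum_ge_0th:
  assumes "\<And>k. F k \<ge> 0"
  shows "F 0 \<le> binsum n F"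
proof -
  have "(\<Sum>k\<in>{0}. real (n choose k) * F k) \<le> binsum n F"
    unfolding binsum_def by (intro sum_mono2) (auto simp: assms)
  then show ?thesis by simp
qed

section \<open>Log-concave sequences\<close>

lemma log_concaveD: "log_concave f \<Longrightarrow> f k * f (Suc (Suc k)) \<le> (f (Suc k))\<^sup>2"
  unfolding log_concave_def by (drule spec[of _ "Suc k"]) simp

lemma log_concaveI:
  assumes "\<And>k. f k * f (Suc (Suc k)) \<le> (f (Suc k))\<^sup>2"
  shows "log_concave f"
  unfolding log_concave_def
proof (intro allI impI)
  fix k :: nat assume "1 \<le> k"
  then obtain j where "k = Suc j" by (cases k) auto
  then show "f (k - 1) * f (k + 1) \<le> (f k)\<^sup>2" using assms[of j] by simp
qed

lemma log_concave_ratio_Suc: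
  assumes "\<And>k. f k > 0" "log_concave f"
  shows "f (Suc (Suc k)) / f (Suc k) \<le> f (Suc k) / f k"
  using log_concaveD[OF assms(2), of k] assms(1)[of k] assms(1)[of "Suc k"]
  by (simp add: field_simps power2_eq_square)

text \<open>Consecutive ratios are nonincreasing, so the odds of a jump are largest at 0. Hence only
  \<open>f 1 / f 0\<close> enters the constants.\<close>

lemma log_concave_ratio_le:
  assumes "\<And>k. f k > 0" "log_concave f"
  shows "f (Suc k) / f k \<le> f 1 / f 0"
proof (induction k)
  case (Suc k)
  then show ?case using log_concave_ratio_Suc[OF assms, of k] by linarith
qed simp

lemma log_concave_add_shift:
  assumes pos: "\<And>k. f k > 0" and lc: "log_concave f"
  shows "log_concave (\<lambda>k. f k + f (Suc k))"
proof (rule log_concaveI)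
  fix k
  define a b c d where "a = f k" "b = f (Suc k)" "c = f (Suc (Suc k))" "d = f (Suc (Suc (Suc k)))"
  note abcd = this
  have p: "a > 0" "b > 0" "c > 0" "d > 0" using pos by (auto simp: abcd)
  have 1: "a * c \<le> b\<^sup>2" "b * d \<le> c\<^sup>2" using log_concaveD[OF lc] by (auto simp: abcd)
  \<comment> \<open>The cross term \<open>a * d\<close> spans three steps, so it takes two
    comparisons of ratios.\<close>
  have "c / b \<le> b / a" "d / c \<le> c / b"
    using log_concave_ratio_Suc[OF pos lc] by (auto simp: abcd)
  then have "d / c \<le> b / a" by linarith
  then have "a * d \<le> b * c" using p by (simp add: field_simps)
  with 1 have "(a + b) * (c + d) \<le> (b + c)\<^sup>2"
    by (simp add: power2_eq_square algebra_simps)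
  then show "(f k + f (Suc k)) * (f (Suc (Suc k)) + f (Suc (Suc (Suc k)))) \<le> (f (Suc k) + f (Suc (Suc k)))\<^sup>2"
    by (simp add: abcd)
qed

section \<open>Convexity of \<open>Psi\<close>\<close>

text \<open>With \<open>w = u + v\<close>, \<open>Psi u v = w * ln (w / u) - (w - u)\<close> is
  homogeneous of degree one in \<open>(u, w)\<close>; the left side is its tangent along the ray
  \<open>w = A * u\<close>. One common \<open>A\<close> reduces joint convexity to adding linear
  bounds.\<close>

lemma Psi_ge_tangent:
  assumes "u > 0" "u + v > 0" "A > 0"
  shows "(u + v) * ln A - (A - 1) * u \<le> Psi u v"
proof -
  define w where "w = u + v"
  have w: "w > 0" and v: "v = w - u" using assms by (auto simp: w_def)
  have "ln (A * u / w) \<le> A * u / w - 1" using assms w by (intro ln_le_minus_one) auto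
  then have "w * (ln A + ln u - ln w) \<le> w * (A * u / w - 1)"
    using assms w by (intro mult_left_mono) (auto simp: ln_div ln_mult)
  also have "\<dots> = A * u - w" using w by (simp add: field_simps)
  finally show ?thesis unfolding Psi_def v by (simp add: algebra_simps)
qed

lemma Psi_eq_tangent:
  assumes "u > 0" "u + v > 0"
  shows "Psi u v = (u + v) * ln ((u + v) / u) - ((u + v) / u - 1) * u"
  using assms by (simp add: Psi_def ln_div field_simps)

text \<open>
  With \<open>p k = f (k + 1) / (f k + f (k + 1))\<close> and \<open>G = (1 - p) g + p g(\<cdot> + 1)\<close>, the pair \<open>(G, DG)\<close>
  at \<open>k\<close> is \<open>(1 - p k) (g k, Dg k) + p (k + 1) (g (k + 1), Dg (k + 1))
  + (p k - p (k + 1)) (g (k + 1), 0)\<close>.  Log-concavity makes the last weight nonnegative, and the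
  claim is joint convexity of \<open>Psi\<close> together with \<open>Psi u 0 = 0\<close>.
\<close>

lemma Psi_average_le:
  fixes f0 f1 f2 g0 g1 g2 :: real
  assumes f: "f0 > 0" "f1 > 0" "f2 > 0" and lc: "f0 * f2 \<le> f1\<^sup>2"
    and g: "g0 > 0" "g1 > 0" "g2 > 0"
  defines "u \<equiv> (f0 * g0 + f1 * g1) / (f0 + f1)"
    and "w \<equiv> (f1 * g1 + f2 * g2) / (f1 + f2)"
  shows "(f0 + f1) * Psi u (w - u) \<le> f0 * Psi g0 (g1 - g0) + f1 * Psi g1 (g2 - g1)"
proof -
  have uw: "u > 0" "w > 0" using f g by (auto simp: u_def w_def intro!: divide_pos_pos add_pos_pos)
  \<comment> \<open>The tangent at the averaged point, where the bound is an equality.\<close>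
  define A where "A = w / u"
  have A: "A > 0" using uw by (simp add: A_def)
  \<comment> \<open>\<open>f0\<close>, \<open>q\<close> and \<open>f1 - q\<close> are the three
    convex weights multiplied by \<open>f0 + f1\<close>; \<open>q \<le> f1\<close> is equivalent to
    \<open>lc\<close>.\<close>
  define q where "q = (f0 + f1) * f2 / (f1 + f2)"
  have q: "q \<ge> 0" "q \<le> f1" using f lc by (auto simp: q_def field_simps power2_eq_square)
  have e: "q * (f1 + f2) = (f0 + f1) * f2" using f by (simp add: q_def)
  have U: "(f0 + f1) * u = f0 * g0 + q * g1 + (f1 - q) * g1"
  proof -
    have "(f0 + f1) * u = f0 * g0 + f1 * g1" using f by (simp add: u_def)
    then show ?thesis by (simp add: algebra_simps)
  qed
  have "(f0 + f1) * w * (f1 + f2) = (f0 * g1 + q * g2 + (f1 - q) * g1) * (f1 + f2)"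
  proof -
    have "(f0 * g1 + q * g2 + (f1 - q) * g1) * (f1 + f2)
        = (f0 + f1) * (f1 + f2) * g1 + (q * (f1 + f2)) * (g2 - g1)"
      by (simp add: algebra_simps)
    also have "\<dots> = (f0 + f1) * (f1 * g1 + f2 * g2)"
      unfolding e by (simp add: algebra_simps)
    finally show ?thesis using f by (simp add: w_def)
  qed
  then have W: "(f0 + f1) * w = f0 * g1 + q * g2 + (f1 - q) * g1" using f by simp
  have "(f0 + f1) * Psi u (w - u) = ((f0 + f1) * w) * ln A - (A - 1) * ((f0 + f1) * u)"
  proof -
    have "Psi u (w - u) = w * ln A - (A - 1) * u"
      using Psi_eq_tangent[of u "w - u"] uw by (simp add: A_def)
    then show ?thesis by (simp only:) (simp add: algebra_simps)
  qed
  also have "\<dots> = f0 * (g1 * ln A - (A - 1) * g0) + q * (g2 * ln A - (A - 1) * g1)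
      + (f1 - q) * (g1 * ln A - (A - 1) * g1)"
    unfolding U W by (simp add: algebra_simps)
  also have "\<dots> \<le> f0 * Psi g0 (g1 - g0) + q * Psi g1 (g2 - g1) + (f1 - q) * Psi g1 0"
    using f q g A Psi_ge_tangent[of g0 "g1 - g0" A] Psi_ge_tangent[of g1 "g2 - g1" A]
      Psi_ge_tangent[of g1 0 A]
    by (intro add_mono mult_left_mono) auto
  also have "\<dots> \<le> f0 * Psi g0 (g1 - g0) + f1 * Psi g1 (g2 - g1)"
    using q g Psi_nonneg[of g1 "g2 - g1"] by (auto simp: Psi_def[of g1 0] intro!: mult_right_mono)
  finally show ?thesis .
qed

section \<open>Entropy along the steps\<close>

text \<open>The right side minus the left side is exactly
  \<open>(f0 + f1) * Psi g0 (u - g0)\<close>.\<close>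

lemma two_point_entropy_le:
  fixes f0 f1 g0 g1 :: real
  assumes f: "f0 > 0" "f1 > 0" and g: "g0 > 0" "g1 > 0"
  defines "u \<equiv> (f0 * g0 + f1 * g1) / (f0 + f1)"
  shows "f0 * (g0 * ln g0) + f1 * (g1 * ln g1) \<le> (f0 + f1) * (u * ln u) + f1 * Psi g0 (g1 - g0)"
proof -
  have u: "u > 0" using f g by (auto simp: u_def intro!: divide_pos_pos add_pos_pos)
  have U: "(f0 + f1) * u = f0 * g0 + f1 * g1" using f by (simp add: u_def)
  have "0 \<le> (f0 + f1) * Psi g0 (u - g0)"
    using f g u by (intro mult_nonneg_nonneg Psi_nonneg) auto
  also have "\<dots> = (f0 + f1) * (u * ln u) - (f0 + f1) * (g0 * ln g0)
      - (ln g0 + 1) * ((f0 + f1) * u - (f0 + f1) * g0)"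
    by (simp add: Psi_def algebra_simps)
  finally show ?thesis unfolding U by (simp add: Psi_def algebra_simps)
qed

text \<open>Trades the one-step constant \<open>r\<close> for \<open>ln (1 + r)\<close>, which
  telescopes, at the cost of a factor uniform over all steps.\<close>

lemma le_mult_ln_one_plus:
  fixes r c :: real
  assumes "0 \<le> r" "r \<le> c"
  shows "r \<le> (1 + c) * ln (1 + r)"
proof -
  have "- ln (1 + r) = ln (inverse (1 + r))" using assms by (simp add: ln_inverse)
  also have "\<dots> \<le> inverse (1 + r) - 1" using assms by (intro ln_le_minus_one) auto
  finally have "r / (1 + r) \<le> ln (1 + r)" using assms by (simp add: field_simps)
  then have "r \<le> (1 + r) * ln (1 + r)" using assms by (simp add: field_simps)
  also have "\<dots> \<le> (1 + c) * ln (1 + r)" using assms by (intro mult_right_mono) auto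
  finally show ?thesis .
qed

text \<open>Dividing by \<open>binsum n f\<close> gives the inequality for the normalised weights,
  whose mass at 0 is \<open>f 0 / binsum n f\<close>. The induction varies \<open>f\<close> and
  \<open>g\<close> but keeps \<open>c\<close> fixed.\<close>

lemma binomial_weighted_entropy_le:
  fixes f g :: "nat \<Rightarrow> real"
  assumes "\<And>k. f k > 0" "log_concave f" "\<And>k. g k > 0" "f 1 / f 0 \<le> c"
  shows "binsum n (\<lambda>k. f k * (g k * ln (g k)))
      - binsum n (\<lambda>k. f k * g k) * ln (binsum n (\<lambda>k. f k * g k) / binsum n f)
    \<le> (1 + c) * ln (binsum n f / f 0) * binsum n (\<lambda>k. f k * Psi (g k) (fwd_diff g k))"
  using assms
proof (induction n arbitrary: f g)
  case 0
  from 0(1)[of 0] show ?case by simp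
next
  case (Suc n)
  note pos = \<open>\<And>k. f k > 0\<close> and lc = \<open>log_concave f\<close> and gpos = \<open>\<And>k. g k > 0\<close>
    and c = \<open>f 1 / f 0 \<le> c\<close>
  define h where "h = (\<lambda>k. f k + f (Suc k))"
  define G where "G = (\<lambda>k. (f k * g k + f (Suc k) * g (Suc k)) / h k)"
  define H where "H = (\<lambda>k. Psi (g k) (fwd_diff g k))"
  define S where "S = binsum (Suc n) (\<lambda>k. f k * H k)"
  define r where "r = f 1 / f 0"
  have hpos: "h k > 0" for k using pos by (simp add: h_def add_pos_pos)
  have Gpos: "G k > 0" for k
    using pos gpos hpos by (simp add: G_def divide_pos_pos add_pos_pos)
  have Hnn: "H k \<ge> 0" for k unfolding H_def using gpos by (rule Psi_fwd_diff_nonneg)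
  have hG: "h k * G k = f k * g k + f (Suc k) * g (Suc k)" for k
    using hpos[of k] by (simp add: G_def)
  have r: "0 \<le> r" "r \<le> c" using pos[of 0] pos[of 1] c by (auto simp: r_def)
  have hlc: "log_concave h" unfolding h_def using pos lc by (rule log_concave_add_shift)
  \<comment> \<open>The initial odds do not grow under the step, so the same \<open>c\<close> serves
    for \<open>h\<close>.\<close>
  have "h 1 / h 0 \<le> r"
    using log_concaveD[OF lc, of 0] pos[of 0] pos[of 1]
    by (simp add: h_def r_def field_simps power2_eq_square)
  then have hc: "h 1 / h 0 \<le> c" using r by linarith
  have Snn: "S \<ge> 0"
    using binsum_mono[of "\<lambda>_. 0" "\<lambda>k. f k * H k" "Suc n"] pos Hnn
    by (simp add: S_def binsum_def less_imp_le)
  have h0: "h 0 \<le> binsum n h" using hpos by (intro binsum_ge_0th) (simp add: less_imp_le)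
  have Zpos: "binsum n h > 0" using h0 hpos[of 0] by linarith
  have lnn: "0 \<le> ln (binsum n h / h 0)" using h0 hpos[of 0] by simp
  have "binsum (Suc n) (\<lambda>k. f k * (g k * ln (g k)))
      \<le> binsum n (\<lambda>k. h k * (G k * ln (G k)) + f (Suc k) * H k)"
    unfolding binsum_Suc
    using two_point_entropy_le[OF pos pos gpos gpos]
    by (intro binsum_mono) (simp add: h_def G_def H_def fwd_diff_def)
  also have "\<dots> = binsum n (\<lambda>k. h k * (G k * ln (G k))) + binsum n (\<lambda>k. f (Suc k) * H k)"
    by (rule binsum_add)
  finally have 1: "binsum (Suc n) (\<lambda>k. f k * (g k * ln (g k))) \<le> \<dots>" .
  have IH: "binsum n (\<lambda>k. h k * (G k * ln (G k)))
      - binsum n (\<lambda>k. h k * G k) * ln (binsum n (\<lambda>k. h k * G k) / binsum n h)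
    \<le> (1 + c) * ln (binsum n h / h 0) * binsum n (\<lambda>k. h k * Psi (G k) (fwd_diff G k))"
    by (rule Suc.IH[OF hpos hlc Gpos hc])
  have "binsum n (\<lambda>k. h k * Psi (G k) (fwd_diff G k)) \<le> S"
    unfolding S_def binsum_Suc
    using Psi_average_le[OF pos pos pos log_concaveD[OF lc] gpos gpos gpos]
    by (intro binsum_mono) (simp add: h_def G_def H_def fwd_diff_def)
  then have 2: "(1 + c) * ln (binsum n h / h 0) * binsum n (\<lambda>k. h k * Psi (G k) (fwd_diff G k))
      \<le> (1 + c) * ln (binsum n h / h 0) * S"
    using lnn r by (intro mult_left_mono) auto
  \<comment> \<open>The cost of the last step: the added nonnegative term completes the Pascal sum
    for \<open>S\<close>.\<close>
  have "binsum n (\<lambda>k. f (Suc k) * H k) \<le> binsum n (\<lambda>k. r * (f k * H k + f (Suc k) * H (Suc k)))"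
  proof (rule binsum_mono)
    fix k
    have "f (Suc k) \<le> r * f k"
      using log_concave_ratio_le[OF pos lc, of k] pos[of k] by (simp add: r_def field_simps)
    then have "f (Suc k) * H k \<le> r * f k * H k" using Hnn by (rule mult_right_mono)
    moreover have "0 \<le> r * (f (Suc k) * H (Suc k))"
      using r pos[of "Suc k"] Hnn by simp
    ultimately show "f (Suc k) * H k \<le> r * (f k * H k + f (Suc k) * H (Suc k))"
      by (simp add: algebra_simps)
  qed
  also have "\<dots> = r * S" by (simp add: binsum_cmult S_def binsum_Suc)
  also have "\<dots> \<le> (1 + c) * ln (1 + r) * S"
    using le_mult_ln_one_plus[OF r] Snn by (rule mult_right_mono)
  finally have 3: "binsum n (\<lambda>k. f (Suc k) * H k) \<le> (1 + c) * ln (1 + r) * S" .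
  \<comment> \<open>This is what makes the logarithms telescope.\<close>
  have "1 + r = h 0 / f 0" using pos[of 0] by (simp add: r_def h_def field_simps)
  then have 4: "ln (binsum n h / f 0) = ln (binsum n h / h 0) + ln (1 + r)"
    using pos[of 0] hpos[of 0] Zpos by (simp add: ln_div)
  have "binsum (Suc n) f = binsum n h" "binsum (Suc n) (\<lambda>k. f k * g k) = binsum n (\<lambda>k. h k * G k)"
    by (simp_all add: binsum_Suc hG) (simp add: h_def)
  with 1 2 3 IH show ?case
    unfolding H_def[symmetric] S_def[symmetric] by (simp add: 4 algebra_simps S_def H_def)
qed

section \<open>Passage to the limit\<close>

lemma falling_ratio_le_1: "real (n choose k) * fact k / real n ^ k \<le> 1"
proof (cases "k \<le> n")
  case True
  have "real ((n choose k) * fact k) \<le> real (n ^ k)"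
    using binomial_fact_pow[of n k] by (subst of_nat_le_iff) (simp add: mult.commute)
  then show ?thesis by (cases "n = 0") (auto simp: divide_le_eq)
qed (simp add: binomial_eq_0)

lemma falling_ratio_tendsto_1: "(\<lambda>n. real (n choose k) * fact k / real n ^ k) \<longlonglongrightarrow> 1"
proof -
  have "(\<lambda>n. \<Prod>i<k. 1 - real i * (1 / real n)) \<longlonglongrightarrow> (\<Prod>i<k. 1 - real i * 0)"
    by (intro tendsto_prod tendsto_diff tendsto_mult tendsto_const lim_1_over_n)
  moreover have "\<forall>\<^sub>F n in sequentially.
      (\<Prod>i<k. 1 - real i * (1 / real n)) = real (n choose k) * fact k / real n ^ k"
    using eventually_gt_at_top[of 0]
  proof eventually_elim
    case (elim n)
    have "real (n choose k) * fact k = (\<Prod>i<k. real n - real i)"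
      using gbinomial_mult_fact[of k "real n"]
      by (simp add: binomial_gbinomial mult.commute atLeast0LessThan)
    also have "\<dots> / real n ^ k = (\<Prod>i<k. (real n - real i) / real n)"
      by (simp add: prod_dividef)
    finally show ?case using elim by (simp add: field_simps)
  qed
  ultimately show ?thesis by (simp add: Lim_transform_eventually)
qed

text \<open>
  The weights \<open>(n choose k) f\<^sub>n k\<close> with \<open>f\<^sub>n k = k! \<mu>(k) / n\<^sup>k\<close> increase to \<open>\<mu>(k)\<close>, while the
  ratio \<open>f\<^sub>n 1 / f\<^sub>n 0 = \<mu>(1) / (n \<mu>(0))\<close> tends to \<open>0\<close>.
\<close>

theorem theorem1p5:
  fixes \<mu> :: "nat pmf" and g :: "nat \<Rightarrow> real"
  assumes "ultra_log_concave \<mu>"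
    and "\<And>k. g k > 0"
    and "integrable (measure_pmf \<mu>) (\<lambda>k. (g k)\<^sup>2)"
  shows "ereal (Ent \<mu> g) \<le>
    ereal \<bar>ln (pmf \<mu> 0)\<bar> * enn2ereal (\<integral>\<^sup>+k. ennreal (Psi (g k) (fwd_diff g k)) \<partial>measure_pmf \<mu>)"
proof -
  define H where "H = (\<lambda>k. Psi (g k) (fwd_diff g k))"
  have gpos: "g k > 0" for k by (rule assms)
  have Hnn: "H k \<ge> 0" for k unfolding H_def using gpos by (rule Psi_fwd_diff_nonneg)
  obtain r f where rf: "r > 0" "\<And>k. f k > 0" "log_concave f"
      "\<And>k. pmf \<mu> k = f k * pmf (poisson_pmf r) k"
    using assms(1) unfolding ultra_log_concave_def by blast
  have pm: "pmf \<mu> k > 0" for k using rf by (simp add: mult_pos_pos)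
  \<comment> \<open>Positive mass at 1 makes \<open>- ln (pmf \<mu> 0)\<close> strictly positive, so
    an infinite expectation gives an infinite right side, not
    \<open>0 * \<infinity> = 0\<close>.\<close>
  have "pmf \<mu> 0 + pmf \<mu> 1 \<le> 1"
    using measure_pmf.prob_le_1[of \<mu> "{0, 1}"] by (simp add: measure_measure_pmf_finite)
  then have p0: "pmf \<mu> 0 < 1" using pm[of 1] by linarith
  have L: "\<bar>ln (pmf \<mu> 0)\<bar> = - ln (pmf \<mu> 0)" "0 < - ln (pmf \<mu> 0)" using pm[of 0] p0 by auto
  show ?thesis
  proof (cases "(\<integral>\<^sup>+k. ennreal (H k) \<partial>measure_pmf \<mu>) = \<infinity>")
    case True
    then show ?thesis using L by (simp add: H_def)
  next
    case False
    then have Hint: "integrable \<mu> H"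
      using Hnn by (intro integrableI_nonneg) (auto simp: less_top)
    define EH where "EH = measure_pmf.expectation \<mu> H"
    have EH: "(\<integral>\<^sup>+k. ennreal (H k) \<partial>measure_pmf \<mu>) = ennreal EH" "EH \<ge> 0"
      using Hint Hnn by (auto simp: EH_def nn_integral_eq_integral)
    have g_int: "integrable \<mu> g"
    proof (rule Bochner_Integration.integrable_bound)
      show "integrable \<mu> (\<lambda>k. 1 + (g k)\<^sup>2)" using assms(3) by simp
      have "\<bar>g k\<bar> \<le> 1 + (g k)\<^sup>2" for k
        using gpos[of k] sum_squares_bound[of 1 "g k"] by (simp add: abs_of_pos)
      then show "AE k in measure_pmf \<mu>. norm (g k) \<le> norm (1 + (g k)\<^sup>2)" by simp
    qed simp
    have gln_int: "integrable \<mu> (\<lambda>k. g k * ln (g k))"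
    proof (rule Bochner_Integration.integrable_bound)
      show "integrable \<mu> (\<lambda>k. 1 + (g k)\<^sup>2)" using assms(3) by simp
      have "\<bar>g k * ln (g k)\<bar> \<le> 1 + (g k)\<^sup>2" for k
      proof -
        have "g k * ln (g k) \<le> g k * g k"
          using gpos[of k] by (intro mult_left_mono) (auto intro: ln_bound)
        moreover have "g k * (- ln (g k)) \<le> g k * (1 / g k)"
          using gpos[of k] ln_bound[of "1 / g k"] by (intro mult_left_mono) (auto simp: ln_div)
        moreover have "g k * (1 / g k) = 1" using gpos[of k] by simp
        ultimately show ?thesis
          using zero_le_power2[of "g k"] unfolding abs_le_iff power2_eq_square by linarith
      qed
      then show "AE k in measure_pmf \<mu>. norm (g k * ln (g k)) \<le> norm (1 + (g k)\<^sup>2)" by simp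
    qed simp
    \<comment> \<open>The density of the approximating weights with respect to \<open>\<mu>\<close>:
      it lies in \<open>[0, 1]\<close> and tends to 1, so dominated convergence applies with bound
      \<open>\<bar>F k\<bar>\<close>.\<close>
    define a where "a = (\<lambda>n k. real (n choose k) * fact k / real n ^ k)"
    have a: "0 \<le> a n k" "a n k \<le> 1" for n k
      using falling_ratio_le_1 by (auto simp: a_def)
    have a_int: "integrable \<mu> (\<lambda>k. a n k * F k)" if "integrable \<mu> F" for n and F :: "nat \<Rightarrow> real"
      by (rule Bochner_Integration.integrable_bound[OF that])
        (use a in \<open>auto simp: abs_mult intro!: mult_left_le_one_le\<close>)
    have a_lim: "(\<lambda>n. measure_pmf.expectation \<mu> (\<lambda>k. a n k * F k)) \<longlonglongrightarrow> measure_pmf.expectation \<mu> F"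
      if "integrable \<mu> F" for F :: "nat \<Rightarrow> real"
    proof (rule integral_dominated_convergence[where w = "\<lambda>k. \<bar>F k\<bar>"])
      have "(\<lambda>n. a n k * F k) \<longlonglongrightarrow> 1 * F k" for k
        unfolding a_def by (intro tendsto_mult falling_ratio_tendsto_1 tendsto_const)
      then show "AE k in measure_pmf \<mu>. (\<lambda>n. a n k * F k) \<longlonglongrightarrow> F k" by simp
    qed (use that a in \<open>auto simp: abs_mult intro!: mult_left_le_one_le\<close>)
    define E where "E = measure_pmf.expectation \<mu> g"
    define c where "c = (\<lambda>n. pmf \<mu> 1 / pmf \<mu> 0 * (1 / real n))"
    define En where "En = (\<lambda>F n. measure_pmf.expectation \<mu> (\<lambda>k. a n k * F k))"
    have ineq: "En (\<lambda>k. g k * ln (g k)) n - En g n * ln (En g n / En (\<lambda>_. 1) n)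
        \<le> (1 + c n) * ln (En (\<lambda>_. 1) n / pmf \<mu> 0) * EH" if n: "n > 0" for n
    proof -
      define fn where "fn = (\<lambda>k. fact k * pmf \<mu> k / real n ^ k)"
      have fn_pos: "fn k > 0" for k using pm n by (simp add: fn_def)
      \<comment> \<open>The factorial cancels the Poisson one, leaving \<open>f\<close> times a
        geometric sequence, which preserves log-concavity.\<close>
      have fn_eq: "fn k = f k * (exp (- r) * (r / real n) ^ k)" for k
        using rf by (simp add: fn_def power_divide)
      have fn_lc: "log_concave fn"
      proof (rule log_concaveI)
        fix k
        have "f k * f (Suc (Suc k)) * (exp (- r) * (r / real n) ^ Suc k)\<^sup>2
            \<le> (f (Suc k))\<^sup>2 * (exp (- r) * (r / real n) ^ Suc k)\<^sup>2"
          by (intro mult_right_mono log_concaveD rf) simp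
        then show "fn k * fn (Suc (Suc k)) \<le> (fn (Suc k))\<^sup>2"
          unfolding fn_eq by (simp only: power_mult_distrib power2_eq_square power_Suc mult_ac)
      qed
      have B: "binsum n (\<lambda>k. fn k * F k) = En F n" for F
      proof -
        \<comment> \<open>The binomial coefficient vanishes for \<open>k > n\<close>, so the
          expectation is a finite sum.\<close>
        have "En F n = (\<Sum>k\<le>n. a n k * F k * pmf \<mu> k)"
          unfolding En_def by (rule integral_measure_pmf_real) (auto simp: a_def not_le intro: leI)
        then show ?thesis by (simp add: binsum_def fn_def a_def mult_ac)
      qed
      have B1: "binsum n fn = En (\<lambda>_. 1) n" using B[of "\<lambda>_. 1"] by simp
      have fn0: "fn 0 = pmf \<mu> 0" by (simp add: fn_def)
      have c: "fn 1 / fn 0 = c n" by (simp add: fn_def c_def)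
      have cnn: "c n \<ge> 0" by (simp add: c_def)
      have l: "0 \<le> ln (En (\<lambda>_. 1) n / pmf \<mu> 0)"
        using binsum_ge_0th[of fn n] fn_pos pm[of 0] by (simp add: B1 fn0 less_imp_le)
      have "En H n \<le> EH"
        unfolding En_def EH_def
        using Hint a Hnn by (intro integral_mono a_int) (auto intro!: mult_left_le_one_le)
      then have "(1 + c n) * ln (En (\<lambda>_. 1) n / pmf \<mu> 0) * En H n
          \<le> (1 + c n) * ln (En (\<lambda>_. 1) n / pmf \<mu> 0) * EH"
        using l cnn by (intro mult_left_mono) auto
      with binomial_weighted_entropy_le[of fn g "c n" n, OF fn_pos fn_lc gpos] c
      show ?thesis unfolding H_def[symmetric] B B1 fn0 by simp
    qed
    have lim: "En F \<longlonglongrightarrow> measure_pmf.expectation \<mu> F" if "integrable \<mu> F" for F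
      unfolding En_def using a_lim[OF that] .
    have l1: "En (\<lambda>_. 1) \<longlonglongrightarrow> 1" using lim[of "\<lambda>_. 1"] by simp
    \<comment> \<open>Positivity of \<open>E\<close> is needed for continuity of \<open>ln\<close>
      at the limit.\<close>
    have "pmf \<mu> 0 * g 0 \<le> E"
    proof -
      have "(\<Sum>k\<in>{0}. g k * pmf \<mu> k) = measure_pmf.expectation \<mu> (\<lambda>k. indicator {0} k * g k)"
        by (subst integral_measure_pmf_real[of "{0}"]) (auto simp: indicator_def)
      also have "\<dots> \<le> E" unfolding E_def
        using g_int gpos by (intro integral_mono integrable_mult_indicator[where 'b=real, simplified])
          (auto simp: indicator_def less_imp_le)
      finally show ?thesis by (simp add: mult.commute)
    qed
    then have Epos: "E > 0" using pm[of 0] gpos[of 0] by (meson less_le_trans mult_pos_pos)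
    have lhs: "(\<lambda>n. En (\<lambda>k. g k * ln (g k)) n - En g n * ln (En g n / En (\<lambda>_. 1) n))
        \<longlonglongrightarrow> measure_pmf.expectation \<mu> (\<lambda>k. g k * ln (g k)) - E * ln (E / 1)"
      using Epos unfolding E_def
      by (intro tendsto_diff tendsto_mult tendsto_ln tendsto_divide lim gln_int g_int l1) auto
    have "(\<lambda>n. (1 + c n) * ln (En (\<lambda>_. 1) n / pmf \<mu> 0) * EH)
        \<longlonglongrightarrow> (1 + pmf \<mu> 1 / pmf \<mu> 0 * 0) * ln (1 / pmf \<mu> 0) * EH"
      unfolding c_def using pm[of 0]
      by (intro tendsto_add tendsto_mult tendsto_ln tendsto_divide tendsto_const l1 lim_1_over_n) auto
    from tendsto_le[OF _ this lhs] have "Ent \<mu> g \<le> \<bar>ln (pmf \<mu> 0)\<bar> * EH"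
      using ineq pm[of 0] L by (auto simp: Ent_def E_def ln_div intro: eventually_mono[OF eventually_gt_at_top[of 0]])
    then show ?thesis using EH by (simp add: H_def enn2ereal_ennreal)
  qed
qed

end
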